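(* Let $C\subset\mathbb{R}^n$ be a closed convex set and let $f:\mathbb{R}^n\to\mathbb{R}$ be continuously differentiable. Assume that there is $L>0$ with $\|\nabla f(x)-\nabla f(y)\|\le L\|x-y\|$ for all $x,y\in C$, and that $\nabla f(x)\in \mathrm{int}(C_\infty)^*$ for all $x\in C$. Consider the Frank--Wolfe algorithm for minimizing $f$ over $C$ described in the context, started from a point $x^0\in C$. Then the sequences $(p^k)\subset C$ and $(x^k)\subset C$ it generates are well defined (at every iteration reached, the set $\operatorname{argmin}_{p\in C}\nabla f(x^k)^T(p-x^k)$ is nonempty, so that $p^k\in C$ and $v_k^*$ exist, and, if the algorithm does not stop, $x^{k+1}$ is defined and belongs to $C$). Moreover, for every iteration $k$ reached, the following hold: (i) $v_k^*\le 0$; (ii) $v_k^*=0$ if and only if $x^k$ is a stationary point of the problem of minimizing $f$ over $C$, i.e. $\nabla f(x^k)^T(x-x^k)\ge 0$ for all $x\in C$; (iii) $v_k^*<0$ if and only if $\lambda_k>0$ and $p^k\ne x^k$.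
   Context: $\|\cdot\|$ is the Euclidean norm on $\mathbb{R}^n$. For a closed convex set $C\subset\mathbb{R}^n$, the asymptotic cone is $C_\infty:=\{d\in\mathbb{R}^n:\ x+td\in C\ \ \forall x\in C,\ \forall t\ge 0\}$ (equivalently, the set of all $d=\lim_k t_k x^k$ with $x^k\in C$, $t_k>0$, $t_k\to 0$), and $\mathrm{int}(C_\infty)^*:=\{x\in\mathbb{R}^n:\ x^Ty>0\ \ \forall y\in C_\infty\setminus\{0\}\}$ is the interior of the positive dual cone of $C_\infty$. Frank--Wolfe algorithm: choose $x^0\in C$. Given $x^k\in C$, choose any $p^k\in\operatorname{argmin}_{p\in C}\nabla f(x^k)^T(p-x^k)$ and set $v_k^*:=\nabla f(x^k)^T(p^k-x^k)$. If $v_k^*=0$, stop. Otherwise compute $\lambda_k$ and set $x^{k+1}:=x^k+\lambda_k(p^k-x^k)$. Here, whenever $p^k\neq x^k$, $\lambda_k$ denotes the number $\lambda_k:=\min\{1,\ |v_k^*|/(L\|p^k-x^k\|^2)\}$ (this formula is also used to give meaning to $\lambda_k$ in (iii) when $v_k^*=0$). *)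

theory Defs
  imports "HOL-Analysis.Analysis"
begin

definition asymptotic_cone :: "'a::real_vector set \<Rightarrow> 'a set" where
  "asymptotic_cone C = {d. \<forall>x\<in>C. \<forall>t\<ge>0. x + t *\<^sub>R d \<in> C}"

(* For the asymptotic cone K of a nonempty closed convex set in R^n this is the
   topological interior of the positive dual cone of K. *)
definition int_dual_cone :: "'a::real_inner set \<Rightarrow> 'a set" where
  "int_dual_cone K = {x. \<forall>y\<in>K - {0}. 0 < x \<bullet> y}"

text \<open>
  In what follows \<open>g\<close> is the gradient of the objective function, \<open>x\<close> the current iterate
  and \<open>p\<close> a solution of the linearised subproblem at \<open>x\<close>.
\<close>

definition fw_argmin :: "'a::real_inner set \<Rightarrow> ('a \<Rightarrow> 'a) \<Rightarrow> 'a \<Rightarrow> 'a set" where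
  "fw_argmin C g x = {p. is_arg_min (\<lambda>p. g x \<bullet> (p - x)) (\<lambda>p. p \<in> C) p}"

definition fw_value :: "('a::real_inner \<Rightarrow> 'a) \<Rightarrow> 'a \<Rightarrow> 'a \<Rightarrow> real" where
  "fw_value g x p = g x \<bullet> (p - x)"

(* Meaningful only for p \<noteq> x; the value 0 that division by zero yields for p = x is never
   relied upon. *)
definition fw_stepsize :: "('a::real_inner \<Rightarrow> 'a) \<Rightarrow> real \<Rightarrow> 'a \<Rightarrow> 'a \<Rightarrow> real" where
  "fw_stepsize g L x p = min 1 (\<bar>fw_value g x p\<bar> / (L * (norm (p - x))\<^sup>2))"

definition fw_next :: "('a::real_inner \<Rightarrow> 'a) \<Rightarrow> real \<Rightarrow> 'a \<Rightarrow> 'a \<Rightarrow> 'a" where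
  "fw_next g L x p = x + fw_stepsize g L x p *\<^sub>R (p - x)"

(* Iteration k is reached, with iterates x 0, ..., x k and choices p 0, ..., p (k - 1):
   none of the iterations 0, ..., k - 1 stopped.  Values of x beyond k and of p from k on are
   unconstrained, and the choice of p k in the argmin set at x k is not part of it. *)
definition fw_reached ::
  "'a::real_inner set \<Rightarrow> ('a \<Rightarrow> 'a) \<Rightarrow> real \<Rightarrow> 'a \<Rightarrow> (nat \<Rightarrow> 'a) \<Rightarrow> (nat \<Rightarrow> 'a) \<Rightarrow> nat \<Rightarrow> bool" where
  "fw_reached C g L x0 x p k \<longleftrightarrow>
     x 0 = x0 \<and>
     (\<forall>j<k. p j \<in> fw_argmin C g (x j) \<and> fw_value g (x j) (p j) \<noteq> 0 \<and>
            x (Suc j) = fw_next g L (x j) (p j))"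

end

theory Submission
  imports Defs
begin

text \<open>
  The only substantial point is that the linearised subproblem has a solution. If a sublevel set of
  \<open>p \<mapsto> c \<bullet> p\<close> on \<open>C\<close> were unbounded, normalised directions towards points of it escaping to
  infinity would accumulate at a unit vector \<open>d\<close> of the asymptotic cone with \<open>c \<bullet> d \<le> 0\<close>,
  contradicting that \<open>c\<close> is positive on the nonzero elements of that cone.
\<close>

text \<open>For \<open>y\<close> in \<open>C\<close> and \<open>t \<ge> 0\<close>, the point of the
  segment from \<open>y\<close> to \<open>q n\<close> with weight \<open>t / r n\<close> is
  eventually in \<open>C\<close> by convexity. As \<open>r n\<close> grows it tends to
  \<open>y + t *\<^sub>R d\<close>, which closedness keeps in \<open>C\<close>.\<close>

lemma asymptotic_cone_limit:
  fixes C :: "'a::real_normed_vector set"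
  assumes "closed C" "convex C" and q: "\<And>n. q n \<in> C"
    and r: "filterlim r at_top sequentially"
    and d: "(\<lambda>n. (q n - z) /\<^sub>R r n) \<longlonglongrightarrow> d"
  shows "d \<in> asymptotic_cone C"
  unfolding asymptotic_cone_def
proof (intro CollectI ballI allI impI)
  fix y t assume y: "y \<in> C" and t: "0 \<le> (t::real)"
  define w where "w n = (1 - t / r n) *\<^sub>R y + (t / r n) *\<^sub>R q n" for n
  \<comment> \<open>Splitting \<open>q n - y\<close> as \<open>(q n - z) + (z - y)\<close> isolates
    the given convergent directions; the change of base point from \<open>z\<close> to
    \<open>y\<close> is divided by \<open>r n\<close> and disappears in the limit.\<close>
  have w_eq: "w n = y + t *\<^sub>R ((q n - z) /\<^sub>R r n) + (t * inverse (r n)) *\<^sub>R (z - y)" for n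
    by (simp add: w_def algebra_simps divide_inverse)
  have "(\<lambda>n. inverse (r n)) \<longlonglongrightarrow> 0"
    using r by (rule tendsto_inverse_0_at_top)
  then have "w \<longlonglongrightarrow> y + t *\<^sub>R d + (t * 0) *\<^sub>R (z - y)"
    unfolding w_eq by (intro tendsto_intros d)
  then have "w \<longlonglongrightarrow> y + t *\<^sub>R d"
    by simp
  \<comment> \<open>The bound 1 makes \<open>r n\<close> positive and the bound \<open>t\<close>
    keeps the weight \<open>t / r n\<close> at most 1.\<close>
  moreover have "eventually (\<lambda>n. max 1 t \<le> r n) sequentially"
    using r by (simp only: filterlim_at_top)
  then have "eventually (\<lambda>n. w n \<in> C) sequentially"
  proof eventually_elim
    case (elim n)
    then have "0 \<le> t / r n" "t / r n \<le> 1"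
      using t by auto
    then show ?case
      unfolding w_def using convexD[OF \<open>convex C\<close> y q] by simp
  qed
  ultimately show "y + t *\<^sub>R d \<in> C"
    using Lim_in_closed_set[OF \<open>closed C\<close>] by (metis sequentially_bot)
qed

lemma bounded_linear_sublevel:
  fixes C :: "'a::euclidean_space set"
  assumes "closed C" "convex C" and c: "c \<in> int_dual_cone (asymptotic_cone C)"
  shows "bounded {p \<in> C. c \<bullet> p \<le> a}"
proof (rule ccontr)
  assume "\<not> bounded {p \<in> C. c \<bullet> p \<le> a}"
  then have "\<exists>p. p \<in> C \<and> c \<bullet> p \<le> a \<and> real n < norm p" for n
    by (auto simp: bounded_iff not_le)
  then obtain q where q: "\<And>n. q n \<in> C" "\<And>n. c \<bullet> q n \<le> a" "\<And>n. real n < norm (q n)"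
    by metis
  have nz: "q n \<noteq> 0" for n
    using q(3)[of n] by auto
  define u where "u n = q n /\<^sub>R norm (q n)" for n
  have "\<forall>n. u n \<in> sphere 0 1"
    using nz by (simp add: u_def)
  then obtain d s where d: "d \<in> sphere 0 1" and s: "strict_mono s" and "(u \<circ> s) \<longlonglongrightarrow> d"
    using compact_sphere[of "0::'a" 1] unfolding compact_def by blast
  then have lim: "(\<lambda>n. q (s n) /\<^sub>R norm (q (s n))) \<longlonglongrightarrow> d"
    by (simp add: u_def o_def)
  have "filterlim (\<lambda>n. norm (q n)) at_top sequentially"
    using q(3) less_imp_le
    by (intro filterlim_at_top_mono[OF filterlim_real_sequentially]) (auto intro: always_eventually)
  then have r: "filterlim (\<lambda>n. norm (q (s n))) at_top sequentially"
    using filterlim_compose filterlim_subseq[OF s] by blast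
  have "d \<in> asymptotic_cone C"
    using assms(1,2) q(1) r lim by (intro asymptotic_cone_limit[where q = "q \<circ> s" and z = 0]) auto
  then have "0 < c \<bullet> d"
    using c d by (auto simp: int_dual_cone_def)
  \<comment> \<open>Dividing \<open>c \<bullet> q (s n) \<le> a\<close> by the norm, which tends to
    infinity, makes the right side vanish whatever the sign of \<open>a\<close>.\<close>
  moreover have "c \<bullet> d \<le> a * 0"
  proof (rule LIMSEQ_le)
    show "(\<lambda>n. c \<bullet> (q (s n) /\<^sub>R norm (q (s n)))) \<longlonglongrightarrow> c \<bullet> d"
      by (intro tendsto_intros lim)
    show "(\<lambda>n. a * inverse (norm (q (s n)))) \<longlonglongrightarrow> a * 0"
      by (intro tendsto_intros tendsto_inverse_0_at_top r)
    show "\<exists>N. \<forall>n\<ge>N. c \<bullet> (q (s n) /\<^sub>R norm (q (s n))) \<le> a * inverse (norm (q (s n)))"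
      using q(2) by (auto simp: mult.commute[of a] intro!: mult_left_mono)
  qed
  ultimately show False
    by simp
qed

lemma fw_argmin_iff: "p \<in> fw_argmin C g x \<longleftrightarrow> p \<in> C \<and> (\<forall>y\<in>C. g x \<bullet> (p - x) \<le> g x \<bullet> (y - x))"
  by (auto simp: fw_argmin_def is_arg_min_linorder)

text \<open>\<open>C\<close> itself may be unbounded, so the minimum is taken over the sublevel set
  through \<open>x\<close>, which is compact and contains \<open>x\<close>.\<close>

lemma fw_argmin_nonempty:
  fixes C :: "'a::euclidean_space set"
  assumes "closed C" "convex C" "x \<in> C" "g x \<in> int_dual_cone (asymptotic_cone C)"
  shows "fw_argmin C g x \<noteq> {}"
proof -
  let ?S = "{p \<in> C. g x \<bullet> p \<le> g x \<bullet> x}"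
  have "closed (C \<inter> {p. g x \<bullet> p \<le> g x \<bullet> x})"
    using \<open>closed C\<close> by (intro closed_Int closed_halfspace_le)
  then have "compact ?S"
    using bounded_linear_sublevel[OF assms(1,2,4)] by (simp add: compact_eq_bounded_closed Collect_conj_eq)
  moreover have "?S \<noteq> {}"
    using \<open>x \<in> C\<close> by auto
  moreover have "continuous_on ?S (\<lambda>p. g x \<bullet> p)"
    by (intro continuous_intros)
  ultimately have "\<exists>p\<in>?S. \<forall>y\<in>?S. g x \<bullet> p \<le> g x \<bullet> y"
    by (rule continuous_attains_inf)
  then obtain p where p: "p \<in> ?S" "\<forall>y\<in>?S. g x \<bullet> p \<le> g x \<bullet> y" ..
  \<comment> \<open>A point of \<open>C\<close> outside \<open>?S\<close> has a value above that of
    \<open>x\<close>, hence above that of \<open>p\<close>.\<close>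
  have "g x \<bullet> p \<le> g x \<bullet> y" if "y \<in> C" for y
    using p that by (cases "y \<in> ?S") auto
  then have "p \<in> fw_argmin C g x"
    using p(1) by (simp add: fw_argmin_iff inner_diff_right)
  then show ?thesis
    by blast
qed

text \<open>The step size lies between 0 and 1, so the new iterate is a convex combination of
  \<open>x\<close> and \<open>p\<close>.\<close>

lemma fw_next_in:
  assumes "convex C" "0 < L" "x \<in> C" "p \<in> C"
  shows "fw_next g L x p \<in> C"
proof -
  let ?l = "fw_stepsize g L x p"
  have "0 \<le> ?l" "?l \<le> 1"
    using \<open>0 < L\<close> by (auto simp: fw_stepsize_def)
  then have "(1 - ?l) *\<^sub>R x + ?l *\<^sub>R p \<in> C"
    using convexD[OF assms(1,3,4)] by simp
  moreover have "fw_next g L x p = (1 - ?l) *\<^sub>R x + ?l *\<^sub>R p"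
    by (simp add: fw_next_def algebra_simps)
  ultimately show ?thesis
    by simp
qed

lemma fw_reached_in:
  assumes "convex C" "0 < L" "x0 \<in> C" "fw_reached C g L x0 x p k"
  shows "x k \<in> C"
  using assms(4)
proof (induction k)
  case 0
  then show ?case using \<open>x0 \<in> C\<close> by (simp add: fw_reached_def)
next
  case (Suc k)
  then have "x k \<in> C" "p k \<in> C" "x (Suc k) = fw_next g L (x k) (p k)"
    by (auto simp: fw_reached_def fw_argmin_iff)
  then show ?case
    using fw_next_in[OF assms(1,2)] by simp
qed

text \<open>For \<open>p \<noteq> x\<close> the denominator is positive, so only the absolute value
  in the numerator decides.\<close>

lemma fw_stepsize_pos_iff:
  assumes "0 < L" "p \<noteq> x"
  shows "0 < fw_stepsize g L x p \<longleftrightarrow> fw_value g x p \<noteq> 0"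
  using assms by (auto simp: fw_stepsize_def zero_less_divide_iff)

theorem lemma3p3:
  fixes C :: "(real ^ 'n) set" and f :: "real ^ 'n \<Rightarrow> real"
    and gradf :: "real ^ 'n \<Rightarrow> real ^ 'n" and L :: real and x0 :: "real ^ 'n"
  assumes "closed C" and "convex C"
    and "\<And>x. GDERIV f x :> gradf x" and "continuous_on UNIV gradf"
    and "0 < L"
    and "\<And>x y. x \<in> C \<Longrightarrow> y \<in> C \<Longrightarrow> norm (gradf x - gradf y) \<le> L * norm (x - y)"
    and "\<And>x. x \<in> C \<Longrightarrow> gradf x \<in> int_dual_cone (asymptotic_cone C)"
    and "x0 \<in> C"
  shows "\<forall>x p k. fw_reached C gradf L x0 x p k \<longrightarrow>
           x k \<in> C \<and> fw_argmin C gradf (x k) \<noteq> {} \<and>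
           (p k \<in> fw_argmin C gradf (x k) \<longrightarrow>
              p k \<in> C \<and>
              (fw_value gradf (x k) (p k) \<noteq> 0 \<longrightarrow>
                 p k \<noteq> x k \<and> fw_next gradf L (x k) (p k) \<in> C) \<and>
              fw_value gradf (x k) (p k) \<le> 0 \<and>
              (fw_value gradf (x k) (p k) = 0 \<longleftrightarrow> (\<forall>y\<in>C. 0 \<le> gradf (x k) \<bullet> (y - x k))) \<and>
              (fw_value gradf (x k) (p k) < 0 \<longleftrightarrow>
                 0 < fw_stepsize gradf L (x k) (p k) \<and> p k \<noteq> x k))"
proof (intro allI impI)
  fix x p k assume reached: "fw_reached C gradf L x0 x p k"
  have x: "x k \<in> C"
    using fw_reached_in[OF assms(2,5,8) reached] .
  have nonempty: "fw_argmin C gradf (x k) \<noteq> {}"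
    using fw_argmin_nonempty[OF assms(1,2) x] assms(7)[OF x] .
  let ?v = "fw_value gradf (x k) (p k)"
  have "p k \<in> C \<and> (?v \<noteq> 0 \<longrightarrow> p k \<noteq> x k \<and> fw_next gradf L (x k) (p k) \<in> C) \<and> ?v \<le> 0 \<and>
      (?v = 0 \<longleftrightarrow> (\<forall>y\<in>C. 0 \<le> gradf (x k) \<bullet> (y - x k))) \<and>
      (?v < 0 \<longleftrightarrow> 0 < fw_stepsize gradf L (x k) (p k) \<and> p k \<noteq> x k)"
    if "p k \<in> fw_argmin C gradf (x k)"
  proof -
    have p: "p k \<in> C" and min: "\<And>y. y \<in> C \<Longrightarrow> ?v \<le> gradf (x k) \<bullet> (y - x k)"
      using that by (auto simp: fw_argmin_iff fw_value_def)
    \<comment> \<open>The current iterate competes in the subproblem with value 0.\<close>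
    have le: "?v \<le> 0"
      using min[OF x] by simp
    have ne: "p k \<noteq> x k" if "?v \<noteq> 0"
      using that by (auto simp: fw_value_def)
    \<comment> \<open>If \<open>?v = 0\<close>, minimality is exactly stationarity; conversely,
      stationarity tested at \<open>p k\<close> gives \<open>?v \<ge> 0\<close>, which meets
      \<open>le\<close>.\<close>
    have stationary: "?v = 0 \<longleftrightarrow> (\<forall>y\<in>C. 0 \<le> gradf (x k) \<bullet> (y - x k))"
      using min le p by (metis fw_value_def order_antisym)
    \<comment> \<open>By \<open>le\<close>, negativity of \<open>?v\<close> amounts to
      \<open>?v \<noteq> 0\<close>, which forces \<open>p k \<noteq> x k\<close> and so puts the
      step size formula in its meaningful range.\<close>
    have "?v < 0 \<longleftrightarrow> 0 < fw_stepsize gradf L (x k) (p k) \<and> p k \<noteq> x k"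
      using le ne fw_stepsize_pos_iff[OF assms(5)] by (metis less_le)
    then show ?thesis
      using p le ne stationary fw_next_in[OF assms(2,5) x p] by blast
  qed
  then show "x k \<in> C \<and> fw_argmin C gradf (x k) \<noteq> {} \<and>
           (p k \<in> fw_argmin C gradf (x k) \<longrightarrow>
              p k \<in> C \<and>
              (?v \<noteq> 0 \<longrightarrow> p k \<noteq> x k \<and> fw_next gradf L (x k) (p k) \<in> C) \<and>
              ?v \<le> 0 \<and>
              (?v = 0 \<longleftrightarrow> (\<forall>y\<in>C. 0 \<le> gradf (x k) \<bullet> (y - x k))) \<and>
              (?v < 0 \<longleftrightarrow> 0 < fw_stepsize gradf L (x k) (p k) \<and> p k \<noteq> x k))"
    using x nonempty by blast
qed

end
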